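(* Let $p$ be an odd prime, let $\mathbb{P}=\mathbb{C}_p[x]$, and let $r\ge1$ be an integer. For every polynomial $q(x)\in\mathbb{P}$, $$\Big\langle \underbrace{\int_{\mathbb{Z}_p}\cdots\int_{\mathbb{Z}_p}}_{r\text{ times}}e^{(x_1+\cdots+x_r)t}\,d\mu_{-1}(x_1)\cdots d\mu_{-1}(x_r)\,\Big|\,q(x)\Big\rangle=\underbrace{\int_{\mathbb{Z}_p}\cdots\int_{\mathbb{Z}_p}}_{r\text{ times}}q(x_1+\cdots+x_r)\,d\mu_{-1}(x_1)\cdots d\mu_{-1}(x_r).$$ Moreover, $$\Big\langle \left(\frac{2}{e^t+1}\right)^r\,\Big|\,q(x)\Big\rangle=\underbrace{\int_{\mathbb{Z}_p}\cdots\int_{\mathbb{Z}_p}}_{r\text{ times}}q(x_1+\cdots+x_r)\,d\mu_{-1}(x_1)\cdots d\mu_{-1}(x_r).$$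
   Context: $p$ is a fixed odd prime; $\mathbb{Z}_p$ is the ring of $p$-adic integers and $\mathbb{C}_p$ is the completion of the algebraic closure of $\mathbb{Q}_p$. Fermionic $p$-adic integral: for a continuous function $f:\mathbb{Z}_p\to\mathbb{C}_p$, $$\int_{\mathbb{Z}_p}f(x)\,d\mu_{-1}(x)=\lim_{N\to\infty}\sum_{x=0}^{p^N-1}f(x)(-1)^x .$$ Multiple integrals are iterated integrals over $x_1,\dots,x_r\in\mathbb{Z}_p$. $\mathcal{F}$ is the algebra of formal power series $f(t)=\sum_{k\ge0}\frac{a_k}{k!}t^k$ with $a_k\in\mathbb{C}_p$. Each $f(t)\in\mathcal{F}$ defines a linear functional on $\mathbb{P}=\mathbb{C}_p[x]$, written $\langle f(t)\,|\,q(x)\rangle$, determined by linearity and $\langle f(t)\,|\,x^n\rangle=a_n$ for all $n\ge0$. The symbol $\int_{\mathbb{Z}_p}\cdots\int_{\mathbb{Z}_p}e^{(x_1+\cdots+x_r)t}\,d\mu_{-1}(x_1)\cdots d\mu_{-1}(x_r)$ ($r$ integrals) denotes the formal power series $\sum_{k\ge0}\left(\int_{\mathbb{Z}_p}\cdots\int_{\mathbb{Z}_p}(x_1+\cdots+x_r)^k\,d\mu_{-1}(x_1)\cdots d\mu_{-1}(x_r)\right)\frac{t^k}{k!}\in\mathcal{F}$. The series $\frac{2}{e^t+1}$, with $e^t=\sum_{k\ge0}t^k/k!$, is the quotient in the ring of formal power series. *)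

theory Defs
  imports "HOL-Analysis.Analysis" "HOL-Computational_Algebra.Computational_Algebra"
begin

definition padic_abs :: "nat \<Rightarrow> rat \<Rightarrow> real" where
  "padic_abs p x =
     (if x = 0 then 0
      else let (a, b) = quotient_of x
           in real p powi (int (multiplicity (int p) b) - int (multiplicity (int p) a)))"

text \<open>
  Complete fields with a multiplicative ultrametric absolute value, which is \<open>\<lambda>x. dist x 0\<close>.
  They are not instances of \<^class>\<open>real_normed_field\<close>, since there is no compatible scalar
  multiplication by reals, and the constant \<open>norm\<close> is restricted to real normed spaces.
\<close>

class complete_ultrametric_field = field_char_0 + complete_space +
  assumes dist_eq_dist_diff: "dist x y = dist (x - y) 0"
    and dist_mult_0: "dist (x * y) 0 = dist x 0 * dist y 0"
    and dist_add_0_le_max: "dist (x + y) 0 \<le> max (dist x 0) (dist y 0)"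

text \<open>
  When the absolute value restricts to the \<open>p\<close>-adic one on the rationals, the closures of the
  integers and of the rationals in the complete field \<open>'c\<close> are the \<open>p\<close>-adic completions
  \<open>Z_p\<close> and \<open>Q_p\<close>.
\<close>

definition padic_ints :: "'c::complete_ultrametric_field set" where
  "padic_ints = closure \<int>"

definition padic_rats :: "'c::complete_ultrametric_field set" where
  "padic_rats = closure \<rat>"

definition padic_algebraic :: "'c::complete_ultrametric_field set" where
  "padic_algebraic =
     {x. \<exists>f. f \<noteq> 0 \<and> (\<forall>i. poly.coeff f i \<in> padic_rats) \<and> poly f x = 0}"

text \<open>
  The type \<open>'c\<close> is the completion \<open>C_p\<close> of an algebraic closure of \<open>Q_p\<close>: its absolute value
  extends the \<open>p\<close>-adic one, the elements algebraic over \<open>Q_p\<close> form an algebraically closed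
  field, and this field is dense in the complete field \<open>'c\<close>. These properties determine \<open>'c\<close>
  up to isometric isomorphism.
\<close>

definition is_padic_complex :: "nat \<Rightarrow> 'c::complete_ultrametric_field itself \<Rightarrow> bool" where
  "is_padic_complex p (_ :: 'c itself) \<longleftrightarrow>
     (\<forall>x. dist (of_rat x :: 'c) 0 = padic_abs p x) \<and>
     (\<forall>f :: 'c poly. degree f > 0 \<longrightarrow> (\<forall>i. poly.coeff f i \<in> padic_algebraic) \<longrightarrow>
        (\<exists>x\<in>padic_algebraic. poly f x = 0)) \<and>
     closure padic_algebraic = (UNIV :: 'c set)"

definition fermionic_integral ::
    "nat \<Rightarrow> ('c \<Rightarrow> 'c) \<Rightarrow> 'c::complete_ultrametric_field" where
  "fermionic_integral p f =
     (if continuous_on padic_ints f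
      then lim (\<lambda>N. \<Sum>x<p ^ N. f (of_nat x) * (- 1) ^ x)
      else undefined)"

text \<open>
  A function of \<open>x_1, ..., x_r\<close> is a function of the list \<open>[x_1, ..., x_r]\<close>. The integral over
  \<open>x_1\<close> is the innermost one, the integral over \<open>x_r\<close> the outermost.
\<close>

primrec fermionic_multi_integral ::
    "nat \<Rightarrow> nat \<Rightarrow> ('c list \<Rightarrow> 'c) \<Rightarrow> 'c::complete_ultrametric_field" where
  "fermionic_multi_integral p 0 f = f []"
| "fermionic_multi_integral p (Suc r) f =
     fermionic_integral p (\<lambda>x. fermionic_multi_integral p r (\<lambda>xs. f (xs @ [x])))"

text \<open>The formal power series denoted by the integral of \<open>exp ((x_1 + ... + x_r) t)\<close>.\<close>

definition fermionic_exp_series :: "nat \<Rightarrow> nat \<Rightarrow> 'c::complete_ultrametric_field fps" where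
  "fermionic_exp_series p r =
     Abs_fps (\<lambda>k. fermionic_multi_integral p r (\<lambda>xs. sum_list xs ^ k) / fact k)"

text \<open>
  For \<open>f = (\<Sum>k. a_k / k! t^k)\<close> this is the linear functional sending \<open>x^n\<close> to \<open>a_n\<close>, where
  \<open>a_n = n! * fps_nth f n\<close>.
\<close>

definition umbral_pairing :: "'c::field_char_0 fps \<Rightarrow> 'c poly \<Rightarrow> 'c" where
  "umbral_pairing f q = (\<Sum>n\<le>degree q. poly.coeff q n * (fact n * fps_nth f n))"

end

theory Submission
  imports Defs
begin

text \<open>
  A power series \<open>f\<close> acts on polynomials as the differential operator \<open>f(D)\<close>, and the umbral
  pairing of \<open>f\<close> and \<open>q\<close> is the value of \<open>f(D) q\<close> at 0. For \<open>g = 2 / (exp t + 1)\<close> the polynomial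
  \<open>Q = g(D) q\<close> satisfies \<open>Q(x + 1) + Q(x) = 2 q(x)\<close>, so the alternating sum of \<open>q\<close> over
  \<open>x < p^N\<close> telescopes to \<open>(Q(0) + Q(p^N)) / 2\<close>, which tends to \<open>Q(0)\<close>. Iterating gives
  \<open>(g^r)(D) q\<close> at 0 for the \<open>r\<close>-fold integral. On monomials this says that the power series of
  the integral of \<open>exp ((x_1 + ... + x_r) t)\<close> is \<open>g^r\<close>.
\<close>

text \<open>Derivatives of order above \<open>degree q\<close> vanish, so the finite sum is all of
  \<open>f(D) q\<close> and no convergence is involved.\<close>

definition fps_diff_op :: "'a::field_char_0 fps \<Rightarrow> 'a poly \<Rightarrow> 'a poly" where
  "fps_diff_op f q = (\<Sum>n\<le>degree q. smult (fps_nth f n) ((pderiv ^^ n) q))"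

lemma higher_pderiv_eq_0:
  fixes q :: "'a::field_char_0 poly"
  assumes "degree q < n"
  shows "(pderiv ^^ n) q = 0"
  using assms by (intro poly_eqI) (simp add: coeff_higher_pderiv coeff_eq_0)

text \<open>Allows a common bound \<open>N\<close> for \<open>q\<close> and for
  \<open>fps_diff_op g q\<close>, whose degree may be smaller.\<close>

lemma fps_diff_op_eq:
  assumes "degree q \<le> N"
  shows "fps_diff_op f q = (\<Sum>n\<le>N. smult (fps_nth f n) ((pderiv ^^ n) q))"
  unfolding fps_diff_op_def using assms
  by (intro sum.mono_neutral_left) (auto simp: higher_pderiv_eq_0)

lemma degree_fps_diff_op_le: "degree (fps_diff_op f q) \<le> degree q"
  unfolding fps_diff_op_def
  by (intro degree_sum_le) (auto intro: order_trans[OF degree_smult_le] simp: degree_higher_pderiv)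

lemma smult_sum_right: "smult c (\<Sum>i\<in>A. f i) = (\<Sum>i\<in>A. smult c (f i))"
  by (induction A rule: infinite_finite_induct) (simp_all add: smult_add_right)

text \<open>Powers of \<open>D\<close> compose by adding exponents, so grouping the double sum by
  \<open>i + j\<close> produces the Cauchy product.\<close>

lemma fps_diff_op_mult: "fps_diff_op (f * g) q = fps_diff_op f (fps_diff_op g q)"
proof -
  define N where "N = degree q"
  define h where "h i j = smult (fps_nth f i * fps_nth g j) ((pderiv ^^ (i + j)) q)" for i j
  have h_support: "i + j \<le> N" if "h i j \<noteq> 0" for i j
    using that higher_pderiv_eq_0[of q "i + j"] by (force simp: h_def N_def not_le)
  have "fps_diff_op f (fps_diff_op g q)
      = (\<Sum>i\<le>N. smult (fps_nth f i) ((pderiv ^^ i) (\<Sum>j\<le>N. smult (fps_nth g j) ((pderiv ^^ j) q))))"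
    unfolding N_def
    by (subst fps_diff_op_eq[OF degree_fps_diff_op_le]) (simp only: fps_diff_op_def)
  also have "\<dots> = (\<Sum>i\<le>N. \<Sum>j\<le>N. h i j)"
    by (simp add: h_def higher_pderiv_sum higher_pderiv_smult smult_sum_right funpow_add)
  also have "\<dots> = (\<Sum>(i, j)\<in>{..N} \<times> {..N}. h i j)"
    by (simp add: sum.cartesian_product)
  \<comment> \<open>Passing from the square to the triangle only drops derivatives of order above
    the degree of \<open>q\<close>.\<close>
  also have "\<dots> = (\<Sum>(i, j)\<in>{(i, j). i + j \<le> N}. h i j)"
    by (intro sum.mono_neutral_right) (auto intro: h_support)
  also have "\<dots> = (\<Sum>k\<le>N. \<Sum>i\<le>k. h i (k - i))"
    by (rule sum.triangle_reindex_eq)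
  also have "\<dots> = (\<Sum>k\<le>N. smult (fps_nth (f * g) k) ((pderiv ^^ k) q))"
    by (intro sum.cong) (auto simp: h_def fps_mult_nth smult_sum atLeast0AtMost)
  also have "\<dots> = fps_diff_op (f * g) q"
    by (simp add: fps_diff_op_def N_def)
  finally show ?thesis by simp
qed

lemma fps_diff_op_add: "fps_diff_op (f + g) q = fps_diff_op f q + fps_diff_op g q"
  by (simp add: fps_diff_op_def smult_add_left sum.distrib)

lemma fps_diff_op_1 [simp]: "fps_diff_op 1 q = q"
proof -
  have "fps_diff_op 1 q = (\<Sum>n\<le>degree q. if n = 0 then q else 0)"
    unfolding fps_diff_op_def by (intro sum.cong) auto
  then show ?thesis by simp
qed

lemma fps_diff_op_numeral [simp]: "fps_diff_op (numeral k) q = smult (numeral k) q"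
proof -
  have "fps_diff_op (numeral k) q = (\<Sum>n\<le>degree q. if n = 0 then smult (numeral k) q else 0)"
    unfolding fps_diff_op_def by (intro sum.cong) (auto simp: fps_numeral_nth)
  then show ?thesis by simp
qed

lemma higher_pderiv_pcompose_shift:
  "(pderiv ^^ n) (pcompose q [:y, 1:]) = pcompose ((pderiv ^^ n) q) [:y, 1:]"
  by (induction n) (simp_all add: pderiv_pcompose pderiv_pCons)

text \<open>Translations commute with \<open>D\<close>, hence with every series in \<open>D\<close>;
  this reduces evaluation at any point to evaluation at 0.\<close>

lemma fps_diff_op_pcompose_shift:
  "fps_diff_op f (pcompose q [:y, 1:]) = pcompose (fps_diff_op f q) [:y, 1:]"
  by (simp add: fps_diff_op_def higher_pderiv_pcompose_shift pcompose_sum pcompose_smult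
      degree_pcompose)

lemma poly_higher_pderiv_0: "poly ((pderiv ^^ n) q) 0 = fact n * coeff q n"
  by (simp add: poly_0_coeff_0 coeff_higher_pderiv pochhammer_fact)

text \<open>Taylor's formula: at 0 the factorials cancel the coefficients of the exponential,
  leaving the sum of the coefficients of the translate \<open>?s\<close>, which is its value at
  1.\<close>

lemma poly_fps_diff_op_exp:
  "poly (fps_diff_op (fps_exp 1) q) x = poly q (x + 1)"
proof -
  let ?s = "pcompose q [:x, 1:]"
  have "poly (fps_diff_op (fps_exp 1) q) x = poly (fps_diff_op (fps_exp 1) ?s) 0"
    by (simp add: fps_diff_op_pcompose_shift poly_pcompose)
  also have "\<dots> = (\<Sum>n\<le>degree ?s. coeff ?s n)"
    by (simp add: fps_diff_op_def poly_sum poly_higher_pderiv_0)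
  also have "\<dots> = poly ?s 1"
    by (simp add: poly_altdef)
  finally show ?thesis by (simp add: poly_pcompose)
qed

lemma umbral_pairing_eq_diff_op: "umbral_pairing f q = poly (fps_diff_op f q) 0"
  by (simp add: umbral_pairing_def fps_diff_op_def poly_sum poly_higher_pderiv_0 mult_ac)

text \<open>Makes the generic limit rules for sums available. The maximum of two distances is at
  most their sum, so the usual triangle bound applies.\<close>

instance complete_ultrametric_field \<subseteq> topological_monoid_add
proof
  fix a b :: 'a
  let ?F = "nhds a \<times>\<^sub>F nhds b"
  let ?B = "\<lambda>z. dist (fst z) a + dist (snd z) b"
  have "dist (x + y) (a + b) \<le> dist x a + dist y b" for x y :: 'a
  proof -
    have "dist (x + y) (a + b) = dist ((x - a) + (y - b)) 0"
      by (simp only: dist_eq_dist_diff[of "x + y"] add_diff_add)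
    then show ?thesis
      using dist_add_0_le_max[of "x - a" "y - b"]
        dist_eq_dist_diff[of x a] dist_eq_dist_diff[of y b]
        zero_le_dist[of x a] zero_le_dist[of y b] by linarith
  qed
  then have "\<forall>\<^sub>F z in ?F. dist (fst z + snd z) (a + b) \<le> dist (?B z) 0"
    by (intro always_eventually) simp
  moreover have "(?B \<longlongrightarrow> dist a a + dist b b) ?F"
    by (intro tendsto_intros filterlim_fst filterlim_snd)
  then have "(?B \<longlongrightarrow> 0) ?F" by simp
  ultimately show "LIM x ?F. fst x + snd x :> nhds (a + b)"
    by (rule metric_tendsto_imp_tendsto[rotated])
qed

instance complete_ultrametric_field \<subseteq> topological_semigroup_mult
proof
  fix a b :: 'a
  let ?F = "nhds a \<times>\<^sub>F nhds b"
  let ?B = "\<lambda>x y. dist x a * dist y b + dist x a * dist b 0 + dist a 0 * dist y b"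
  have "dist (x * y) (a * b) \<le> ?B x y" for x y :: 'a
  proof -
    have "x * y - a * b = ((x - a) * (y - b) + (x - a) * b) + a * (y - b)"
      by (simp add: algebra_simps)
    moreover have "dist (u + v) 0 \<le> dist u 0 + dist v 0" for u v :: 'a
      using dist_add_0_le_max[of u v] zero_le_dist[of u 0] zero_le_dist[of v 0] by linarith
    ultimately have "dist (x * y - a * b) 0
        \<le> dist ((x - a) * (y - b)) 0 + dist ((x - a) * b) 0 + dist (a * (y - b)) 0"
      by (metis (no_types, opaque_lifting) add_right_mono order_trans)
    then show ?thesis
      by (simp only: dist_mult_0 flip: dist_eq_dist_diff)
  qed
  then have "\<forall>\<^sub>F z in ?F. dist (fst z * snd z) (a * b) \<le> dist (?B (fst z) (snd z)) 0"
    by (intro always_eventually) simp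
  moreover have "((\<lambda>z. ?B (fst z) (snd z)) \<longlongrightarrow> ?B a b) ?F"
    by (intro tendsto_intros filterlim_fst filterlim_snd)
  then have "((\<lambda>z. ?B (fst z) (snd z)) \<longlongrightarrow> 0) ?F" by simp
  ultimately show "LIM x ?F. fst x * snd x :> nhds (a * b)"
    by (rule metric_tendsto_imp_tendsto[rotated])
qed

lemma tendsto_poly_ultrametric:
  fixes q :: "'c::complete_ultrametric_field poly"
  assumes "(f \<longlongrightarrow> a) F"
  shows "((\<lambda>x. poly q (f x)) \<longlongrightarrow> poly q a) F"
proof (induction q)
  case (pCons c q)
  show ?case
    unfolding poly_pCons by (intro tendsto_add tendsto_mult tendsto_const assms pCons.IH)
qed simp

text \<open>The absolute value of \<open>p ^ N\<close> is \<open>p\<close> to the power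
  \<open>-N\<close>.\<close>

lemma tendsto_prime_power_0:
  assumes "prime p" and "is_padic_complex p TYPE('c::complete_ultrametric_field)"
  shows "(\<lambda>N. of_nat (p ^ N) :: 'c) \<longlonglongrightarrow> 0"
proof -
  have "p > 1" using assms(1) by (rule prime_gt_1_nat)
  have "dist (of_nat (p ^ N) :: 'c) 0 = inverse (real p) ^ N" for N
  proof -
    have "dist (of_nat (p ^ N) :: 'c) 0 = padic_abs p (of_nat (p ^ N))"
      using assms(2) unfolding is_padic_complex_def by (metis of_rat_of_nat_eq)
    also have "\<dots> = real p powi (- int N)"
      using \<open>p > 1\<close> quotient_of_rat_of_nat[of "p ^ N"]
      by (simp add: padic_abs_def multiplicity_same_power del: quotient_of_rat_of_nat)
    finally show ?thesis by (simp add: power_int_minus power_inverse)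
  qed
  then show ?thesis
    using \<open>p > 1\<close>
    by (subst tendsto_dist_iff) (simp add: LIMSEQ_power_zero inverse_less_1_iff)
qed

lemma alternating_sum_telescope:
  fixes Q :: "nat \<Rightarrow> 'a::comm_ring_1"
  shows "(\<Sum>x<n. (Q (Suc x) + Q x) * (- 1) ^ x) = Q 0 - (- 1) ^ n * Q n"
  by (induction n) (simp_all add: algebra_simps)

text \<open>The constant term of the denominator is 2, nonzero in characteristic 0, so the
  denominator is a unit and the division is exact.\<close>

lemma fps_exp_plus_1_quotient:
  "(2 / (fps_exp 1 + 1)) * (fps_exp 1 + 1) = (2 :: 'a::field_char_0 fps)"
proof -
  have "is_unit (fps_exp 1 + 1 :: 'a fps)"
    by (simp add: fps_is_unit_iff)
  then show ?thesis
    by (intro dvd_div_mult_self) (rule unit_imp_dvd)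
qed

lemma fermionic_integral_poly:
  fixes q :: "'c::complete_ultrametric_field poly"
  assumes "prime p" "odd p" "is_padic_complex p TYPE('c)"
  shows "fermionic_integral p (poly q) = poly (fps_diff_op (2 / (fps_exp 1 + 1)) q) 0"
proof -
  define Q where "Q = fps_diff_op (2 / (fps_exp 1 + 1)) q"
  have "fps_diff_op (fps_exp 1 + 1) Q = smult 2 q"
    using fps_exp_plus_1_quotient[where 'a = 'c]
    by (simp add: Q_def mult.commute flip: fps_diff_op_mult)
  then have Q: "poly Q (x + 1) + poly Q x = 2 * poly q x" for x
    by (metis fps_diff_op_1 fps_diff_op_add poly_add poly_fps_diff_op_exp poly_smult)
  have Q_nat: "poly Q (of_nat (Suc x)) + poly Q (of_nat x) = 2 * poly q (of_nat x)" for x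
    using Q[of "of_nat x"] by (simp add: add.commute)
  have sum: "(\<Sum>x<p ^ N. poly q (of_nat x) * (- 1) ^ x)
      = (poly Q 0 + poly Q (of_nat (p ^ N))) / 2" for N
  proof -
    have "2 * (\<Sum>x<p ^ N. poly q (of_nat x) * (- 1) ^ x)
        = (\<Sum>x<p ^ N. (poly Q (of_nat (Suc x)) + poly Q (of_nat x)) * (- 1) ^ x)"
      by (simp only: Q_nat sum_distrib_left mult.assoc)
    also have "\<dots> = poly Q 0 + poly Q (of_nat (p ^ N))"
      \<comment> \<open>As \<open>p\<close> is odd, so is \<open>p ^ N\<close>, and the boundary
        term at \<open>p ^ N\<close> enters with a plus sign.\<close>
      using alternating_sum_telescope[of "\<lambda>x. poly Q (of_nat x)" "p ^ N"] assms(2) by simp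
    finally show ?thesis by (simp add: field_simps)
  qed
  \<comment> \<open>Halving is written as multiplication by a constant, so continuity of sums and
    products suffices.\<close>
  have "(\<lambda>N. (poly Q 0 + poly Q (of_nat (p ^ N))) * inverse 2) \<longlonglongrightarrow> (poly Q 0 + poly Q 0) * inverse 2"
    by (intro tendsto_intros tendsto_poly_ultrametric tendsto_prime_power_0 assms)
  then have "(\<lambda>N. \<Sum>x<p ^ N. poly q (of_nat x) * (- 1) ^ x) \<longlonglongrightarrow> poly Q 0"
    by (simp only: sum divide_inverse) simp
  \<comment> \<open>Without continuity \<open>fermionic_integral\<close> would be
    \<open>undefined\<close>.\<close>
  moreover have "continuous_on padic_ints (poly q)"
    unfolding continuous_on_def by (auto intro!: tendsto_poly_ultrametric)
  ultimately show ?thesis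
    by (simp add: fermionic_integral_def limI Q_def)
qed

lemma fermionic_multi_integral_poly_sum_list:
  fixes q :: "'c::complete_ultrametric_field poly"
  assumes "prime p" "odd p" "is_padic_complex p TYPE('c)"
  shows "fermionic_multi_integral p r (\<lambda>xs. poly q (sum_list xs))
    = poly (fps_diff_op ((2 / (fps_exp 1 + 1)) ^ r) q) 0"
proof (induction r arbitrary: q)
  case 0
  show ?case by simp
next
  case (Suc r)
  let ?g = "2 / (fps_exp 1 + 1) :: 'c fps"
  have "fermionic_multi_integral p r (\<lambda>xs. poly q (sum_list (xs @ [x])))
      = poly (fps_diff_op (?g ^ r) q) x" for x
    \<comment> \<open>The outermost variable \<open>x\<close> is absorbed into the polynomial as a
      translation. The inner integral is then a polynomial in \<open>x\<close>, to which the
      single-integral formula applies.\<close>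
    using Suc.IH[of "pcompose q [:x, 1:]"]
    by (simp add: poly_pcompose fps_diff_op_pcompose_shift add.commute)
  then show ?case
    by (simp only: fermionic_multi_integral.simps fermionic_integral_poly[OF assms]
        power_Suc fps_diff_op_mult)
qed

text \<open>Testing the integral formula on the monomial of degree \<open>k\<close> isolates the
  coefficient of index \<open>k\<close>.\<close>

lemma fermionic_exp_series_eq:
  assumes "prime p" "odd p" "is_padic_complex p TYPE('c::complete_ultrametric_field)"
  shows "fermionic_exp_series p r = (2 / (fps_exp 1 + 1) :: 'c fps) ^ r"
proof (rule fps_ext)
  fix k
  let ?g = "2 / (fps_exp 1 + 1) :: 'c fps"
  have "fermionic_multi_integral p r (\<lambda>xs. sum_list xs ^ k :: 'c) = umbral_pairing (?g ^ r) (monom 1 k)"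
    using fermionic_multi_integral_poly_sum_list[OF assms, of r "monom 1 k"]
    by (simp add: poly_monom umbral_pairing_eq_diff_op)
  also have "\<dots> = fact k * fps_nth (?g ^ r) k"
    by (simp add: umbral_pairing_def degree_monom_eq if_distrib[where f = "\<lambda>c. c * _"] cong: if_cong)
  finally show "fps_nth (fermionic_exp_series p r) k = fps_nth (?g ^ r) k"
    by (simp add: fermionic_exp_series_def)
qed

theorem theorem2p4:
  fixes p r :: nat and q :: "'c::complete_ultrametric_field poly"
  assumes "prime p" and "odd p"
    and "is_padic_complex p TYPE('c)"
    and "r \<ge> 1"
  shows "umbral_pairing (fermionic_exp_series p r) q
           = fermionic_multi_integral p r (\<lambda>xs. poly q (sum_list xs))
       \<and> umbral_pairing ((2 / (fps_exp 1 + 1)) ^ r) q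
           = fermionic_multi_integral p r (\<lambda>xs. poly q (sum_list xs))"
  using assms
  by (simp add: fermionic_exp_series_eq fermionic_multi_integral_poly_sum_list umbral_pairing_eq_diff_op)

end
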